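(* Let $\mathfrak{q}\in\mathbb{R}\setminus\{0\}$ and consider, on $0<u<1$, the sound-channel equation with the dilaton fluctuation set to zero, $$Z''+\frac{\mathfrak{q}^2u-2\mathfrak{w}^2}{(1-u)(\mathfrak{q}^2(u-2)+2\mathfrak{w}^2)}Z'+\frac{-4u^2(1-u)\mathfrak{q}^2+(u^2-3u+2)\mathfrak{q}^4+(3u-4)\mathfrak{q}^2\mathfrak{w}^2+2\mathfrak{w}^4}{4u^2(1-u)^2(\mathfrak{q}^2(u-2)+2\mathfrak{w}^2)}Z=0 .$$ Write $Z=u^{\rho/2}(1-u)^{\sigma/2}y(u)$ with $\rho=1+\sqrt{1+\mathfrak{q}^2-\mathfrak{w}^2}$ (principal square root) and $\sigma=-i\mathfrak{w}$. Then for $$\mathfrak{w}=-i\,\frac{\mathfrak{q}^2}{2}$$ the constant function $y(u)=1$ gives a solution. Hence there is a sound mode satisfying the quasinormal boundary conditions whose dispersion relation has no term linear in $\mathfrak{q}$, i.e. the speed of sound is $v_s=\lim_{\mathfrak{q}\to0}\mathfrak{w}(\mathfrak{q})/\mathfrak{q}=0$.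
   Context: Here $\mathfrak{w},\mathfrak{q}$ are the dimensionless frequency and momentum of a fluctuation of the linear dilaton black hole, $u=0$ is spatial infinity and $u=1$ is the horizon. The quasinormal boundary conditions are: at the horizon $u\to1^-$, $Z\sim(1-u)^{-i\mathfrak{w}/2}$ (i.e. $y$ regular and nonzero at $u=1$); at infinity $u\to0^+$, $Z\sim u^{\rho/2}$ (i.e. $y$ regular and nonzero at $u=0$), the square root being on the sheet with positive real part. *)

theory Defs
  imports "HOL-Complex_Analysis.Complex_Analysis"
begin

text \<open>
  Throughout, \<open>q\<close> is the (real) dimensionless momentum, \<open>w\<close> the (complex) dimensionless
  frequency, and \<open>u\<close> the radial coordinate, with spatial infinity at \<open>u = 0\<close> and the horizon
  at \<open>u = 1\<close>.
\<close>

definition sound_denom :: "real \<Rightarrow> complex \<Rightarrow> real \<Rightarrow> complex" where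
  "sound_denom q w u = of_real (q^2 * (u - 2)) + 2 * w^2"

text \<open>The coefficients of \<open>Z'\<close> and of \<open>Z\<close> in the sound-channel equation with vanishing
  dilaton fluctuation.\<close>

definition sound_coeff1 :: "real \<Rightarrow> complex \<Rightarrow> real \<Rightarrow> complex" where
  "sound_coeff1 q w u =
     (of_real (q^2 * u) - 2 * w^2) / (of_real (1 - u) * sound_denom q w u)"

definition sound_coeff0 :: "real \<Rightarrow> complex \<Rightarrow> real \<Rightarrow> complex" where
  "sound_coeff0 q w u =
     (of_real (- 4 * u^2 * (1 - u) * q^2) + of_real ((u^2 - 3 * u + 2) * q^4)
        + of_real ((3 * u - 4) * q^2) * w^2 + 2 * w^4)
     / (of_real (4 * u^2 * (1 - u)^2) * sound_denom q w u)"

text \<open>The first conjunct requires the coefficients to be genuinely defined at every point, so that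
  the convention \<open>x / 0 = 0\<close> plays no role.\<close>

definition sound_solution :: "real \<Rightarrow> complex \<Rightarrow> (real \<Rightarrow> complex) \<Rightarrow> bool" where
  "sound_solution q w Z \<longleftrightarrow>
     (\<exists>Z' Z''. \<forall>u\<in>{0<..<1}.
        sound_denom q w u \<noteq> 0 \<and>
        (Z has_vector_derivative Z' u) (at u) \<and>
        (Z' has_vector_derivative Z'' u) (at u) \<and>
        Z'' u + sound_coeff1 q w u * Z' u + sound_coeff0 q w u * Z u = 0)"

definition infinity_root :: "real \<Rightarrow> complex \<Rightarrow> complex" where
  "infinity_root q w = csqrt (1 + of_real (q^2) - w^2)"

definition rho :: "real \<Rightarrow> complex \<Rightarrow> complex" where
  "rho q w = 1 + infinity_root q w"

definition sigma :: "complex \<Rightarrow> complex" where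
  "sigma w = - \<i> * w"

definition sound_ansatz :: "real \<Rightarrow> complex \<Rightarrow> (complex \<Rightarrow> complex) \<Rightarrow> real \<Rightarrow> complex" where
  "sound_ansatz q w y u =
     of_real u powr (rho q w / 2) * of_real (1 - u) powr (sigma w / 2) * y (of_real u)"

text \<open>
  Regularity of \<open>y\<close> at the end points is analyticity there. Mere boundedness would not do: it
  admits an admixture of the subdominant Frobenius solution, e.g. of the outgoing wave
  \<open>(1 - u) powr (\<i> * w / 2)\<close> at the horizon when \<open>Im w < 0\<close>. This is why \<open>y\<close> takes a
  complex argument; on the open interval only its values at real \<open>u\<close> matter. The condition on
  \<^const>\<open>infinity_root\<close> excludes the branch cut of \<^const>\<open>csqrt\<close>, where the real part vanishes.
\<close>

definition sound_quasinormal_mode :: "real \<Rightarrow> complex \<Rightarrow> (real \<Rightarrow> complex) \<Rightarrow> bool" where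
  "sound_quasinormal_mode q w Z \<longleftrightarrow>
     sound_solution q w Z \<and>
     0 < Re (infinity_root q w) \<and>
     (\<exists>y. (\<forall>u\<in>{0<..<1}. Z u = sound_ansatz q w y u) \<and>
          y analytic_on {0, 1} \<and> y 0 \<noteq> 0 \<and> y 1 \<noteq> 0)"

end

theory Submission
  imports Defs
begin

text \<open>
  For \<open>w = - \<i> q\<^sup>2 / 2\<close> the radicand \<open>1 + q\<^sup>2 - w\<^sup>2\<close> is the square of \<open>1 + q\<^sup>2 / 2\<close>, so both exponents are
  real and, with \<open>t = q\<^sup>2 / 4\<close>, the candidate is \<open>Z = u powr (1 + t) * (1 - u) powr (- t)\<close>. It satisfies
  \<open>Z' / Z = (1 + t - u) / (u (1 - u))\<close> and \<open>Z'' / Z = t (1 + t) / (u (1 - u))\<^sup>2\<close>, which turns the equation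
  into a polynomial identity in \<open>t\<close> and \<open>u\<close>.
\<close>

definition sound_freq :: "real \<Rightarrow> complex" where
  "sound_freq q = - \<i> * of_real (q^2 / 2)"

text \<open>Kept real-valued so that differentiation and algebra take place over the reals; complex
  values enter only through \<open>of_real\<close>.\<close>

definition sound_profile :: "real \<Rightarrow> real \<Rightarrow> real" where
  "sound_profile t u = u powr (1 + t) * (1 - u) powr (- t)"

lemma sound_freq_power2: "sound_freq q ^ 2 = - of_real (q ^ 4 / 4)"
  by (simp add: sound_freq_def power_mult_distrib power_divide flip: power_mult)

lemma sound_freq_power4: "sound_freq q ^ 4 = of_real (q ^ 8 / 16)"
proof -
  have "sound_freq q ^ 4 = (sound_freq q ^ 2) ^ 2"
    by (simp flip: power_mult)
  then show ?thesis
    by (simp add: sound_freq_power2 power_divide flip: power_mult)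
qed

lemma infinity_root_sound_freq: "infinity_root q (sound_freq q) = of_real (1 + q^2 / 2)"
proof -
  have "1 + of_real (q^2) - sound_freq q ^ 2 = of_real ((1 + q^2 / 2) ^ 2)"
    unfolding sound_freq_power2
    by (simp add: power2_eq_square power4_eq_xxxx field_simps)
  \<comment> \<open>Positivity is what makes the principal root \<open>1 + q^2 / 2\<close> and not
    its negative.\<close>
  moreover have "0 < 1 + q^2 / 2"
    by (simp add: add_pos_nonneg)
  ultimately show ?thesis
    unfolding infinity_root_def by (simp add: csqrt_square)
qed

lemma rho_sound_freq: "rho q (sound_freq q) / 2 = of_real (1 + q^2 / 4)"
  by (simp add: rho_def infinity_root_sound_freq field_simps)

lemma sigma_sound_freq: "sigma (sound_freq q) / 2 = of_real (- (q^2 / 4))"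
  by (simp add: sigma_def sound_freq_def)

lemma sound_ansatz_sound_freq:
  assumes "0 < u" "u < 1"
  shows "sound_ansatz q (sound_freq q) (\<lambda>_. 1) u = of_real (sound_profile (q^2 / 4) u)"
  using assms
  by (simp only: sound_ansatz_def rho_sound_freq sigma_sound_freq sound_profile_def
      powr_of_real of_real_mult mult_1_right)

text \<open>The logarithmic derivative is \<open>(1 + t) / u + t / (1 - u)\<close>; over the common
  denominator the terms in \<open>t * u\<close> cancel.\<close>

lemma sound_profile_deriv:
  assumes "0 < u" "u < 1"
  shows "(sound_profile t has_real_derivative
           sound_profile t u * ((1 + t - u) / (u * (1 - u)))) (at u)"
proof -
  have "(sound_profile t has_real_derivative
          (1 + t) * u powr t * (1 - u) powr (- t) +
          u powr (1 + t) * (t * (1 - u) powr (- t - 1))) (at u)"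
    unfolding sound_profile_def using assms
    by (auto intro!: derivative_eq_intros)
  moreover have "(1 + t) * u powr t * (1 - u) powr (- t) +
          u powr (1 + t) * (t * (1 - u) powr (- t - 1))
        = sound_profile t u * ((1 + t - u) / (u * (1 - u)))"
    unfolding sound_profile_def using assms
    by (simp add: powr_add powr_diff field_simps)
  ultimately show ?thesis
    by simp
qed

text \<open>With \<open>L\<close> the logarithmic derivative, the second derivative is the profile
  times \<open>L' + L^2\<close>. In the numerator of this sum all dependence on \<open>u\<close>
  cancels, leaving \<open>t * (1 + t)\<close>.\<close>

lemma sound_profile_deriv2:
  assumes "0 < u" "u < 1"
  shows "((\<lambda>u. sound_profile t u * ((1 + t - u) / (u * (1 - u)))) has_real_derivative
           sound_profile t u * (t * (1 + t) / (u * (1 - u))^2)) (at u)"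
proof -
  have "((\<lambda>u. (1 + t - u) / (u * (1 - u))) has_real_derivative
          (- (u * (1 - u)) - (1 + t - u) * (1 - 2 * u)) / (u * (1 - u))^2) (at u)"
    using assms by (auto intro!: derivative_eq_intros simp: power2_eq_square)
  from DERIV_mult[OF sound_profile_deriv[OF assms] this]
  show ?thesis
    by (rule DERIV_cong) (use assms in \<open>simp add: divide_simps; algebra\<close>)
qed

text \<open>At this frequency a factor \<open>q^2\<close> splits off. It cancels from both
  coefficients, and the remaining factor is negative for \<open>u < 1\<close>.\<close>

lemma sound_denom_sound_freq:
  "sound_denom q (sound_freq q) u = of_real (q^2 * (u - 2 - q^2 / 2))"
  unfolding sound_denom_def sound_freq_power2
  by (simp add: power2_eq_square power4_eq_xxxx algebra_simps)

lemma sound_coeff1_sound_freq: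
  assumes "q \<noteq> 0"
  shows "sound_coeff1 q (sound_freq q) u =
    of_real ((u + q^2 / 2) / ((1 - u) * (u - 2 - q^2 / 2)))"
proof -
  have "sound_coeff1 q (sound_freq q) u =
    of_real ((q^2 * (u + q^2 / 2)) / ((1 - u) * (q^2 * (u - 2 - q^2 / 2))))"
    unfolding sound_coeff1_def sound_denom_sound_freq sound_freq_power2
    by (simp add: power2_eq_square power4_eq_xxxx algebra_simps)
  then show ?thesis
    using assms by simp
qed

lemma sound_coeff0_sound_freq:
  assumes "q \<noteq> 0"
  shows "sound_coeff0 q (sound_freq q) u =
    of_real ((u^2 * (u - 1) + (u^2 - 3 * u + 2) * (q^2 / 4)
        - (3 * u - 4) * (q^2 / 4)^2 + 2 * (q^2 / 4)^3)
      / (u^2 * (1 - u)^2 * (u - 2 - q^2 / 2)))" (is "_ = of_real (?n / ?d)")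
proof -
  \<comment> \<open>Numerator and denominator share the factor \<open>4 * q^2\<close>; what is left
    of the numerator is a polynomial in \<open>u\<close> and \<open>q^2 / 4\<close>.\<close>
  have n: "of_real (- 4 * u^2 * (1 - u) * q^2) + of_real ((u^2 - 3 * u + 2) * q^4)
        + of_real ((3 * u - 4) * q^2) * sound_freq q ^ 2 + 2 * sound_freq q ^ 4
      = complex_of_real (4 * q^2 * ?n)"
    unfolding sound_freq_power2 sound_freq_power4 of_real_minus[symmetric] of_real_mult[symmetric]
      of_real_add[symmetric] of_real_numeral[where 'a = complex, symmetric] of_real_eq_iff
    by (simp add: field_simps)
  have d: "of_real (4 * u^2 * (1 - u)^2) * sound_denom q (sound_freq q) u
      = complex_of_real (4 * q^2 * ?d)"
    by (simp add: sound_denom_sound_freq mult_ac)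
  show ?thesis
    unfolding sound_coeff0_def n d of_real_divide[symmetric] of_real_eq_iff using assms
    by simp
qed

lemma sound_equation_identity:
  fixes t u :: real
  assumes "0 < u" "u < 1" "0 < t"
  shows "t * (1 + t) / (u * (1 - u))^2
      + (u + 2 * t) / ((1 - u) * (u - 2 - 2 * t)) * ((1 + t - u) / (u * (1 - u)))
      + (u^2 * (u - 1) + (u^2 - 3 * u + 2) * t - (3 * u - 4) * t^2 + 2 * t^3)
         / (u^2 * (1 - u)^2 * (u - 2 - 2 * t)) = 0"
proof -
  \<comment> \<open>Naming the factors \<open>1 - u\<close> and \<open>u - 2 - 2 * t\<close> keeps
    them atomic and nonzero while fractions are combined over \<open>u^2 * v^2 * d\<close>; they are
    expanded only afterwards, when the numerator vanishes identically.\<close>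
  define v where "v = 1 - u"
  define d where "d = u - 2 - 2 * t"
  have nz: "u \<noteq> 0" "v \<noteq> 0" "d \<noteq> 0"
    using assms by (auto simp: v_def d_def)
  have "t * (1 + t) / (u * v)^2 + (u + 2 * t) / (v * d) * ((1 + t - u) / (u * v))
      + (u^2 * (u - 1) + (u^2 - 3 * u + 2) * t - (3 * u - 4) * t^2 + 2 * t^3) / (u^2 * v^2 * d)
    = (t * (1 + t) * d + (u + 2 * t) * (1 + t - u) * u
        + (u^2 * (u - 1) + (u^2 - 3 * u + 2) * t - (3 * u - 4) * t^2 + 2 * t^3)) / (u^2 * v^2 * d)"
    using nz by (simp add: divide_simps power2_eq_square)
  also have "\<dots> = 0"
    unfolding v_def d_def
    by (simp add: algebra_simps power2_eq_square power3_eq_cube)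
  finally show ?thesis
    unfolding v_def d_def .
qed

lemma sound_solution_sound_freq:
  assumes "q \<noteq> 0"
  shows "sound_solution q (sound_freq q) (sound_ansatz q (sound_freq q) (\<lambda>_. 1))"
proof -
  define t where "t = q^2 / 4"
  have t: "0 < t" "q^2 / 2 = 2 * t"
    using assms by (simp_all add: t_def)
  define Z' where "Z' u = sound_profile t u * ((1 + t - u) / (u * (1 - u)))" for u
  define Z'' where "Z'' u = sound_profile t u * (t * (1 + t) / (u * (1 - u))^2)" for u
  have "sound_denom q (sound_freq q) u \<noteq> 0 \<and>
      (sound_ansatz q (sound_freq q) (\<lambda>_. 1) has_vector_derivative of_real (Z' u)) (at u) \<and>
      ((\<lambda>u. complex_of_real (Z' u)) has_vector_derivative of_real (Z'' u)) (at u) \<and>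
      of_real (Z'' u) + sound_coeff1 q (sound_freq q) u * of_real (Z' u)
        + sound_coeff0 q (sound_freq q) u * sound_ansatz q (sound_freq q) (\<lambda>_. 1) u = 0"
    if "u \<in> {0<..<1}" for u
  proof (intro conjI)
    have u: "0 < u" "u < 1"
      using that by auto
    show "sound_denom q (sound_freq q) u \<noteq> 0"
      unfolding sound_denom_sound_freq of_real_eq_0_iff t(2) using assms u t(1) by simp
    have "((\<lambda>u. complex_of_real (sound_profile t u)) has_vector_derivative of_real (Z' u)) (at u)"
      unfolding Z'_def
      by (intro has_vector_derivative_of_real sound_profile_deriv u)
    \<comment> \<open>The ansatz has been identified with the real profile only for
      \<open>0 < u < 1\<close>; as this interval is open, the derivative carries over.\<close>
    then show "(sound_ansatz q (sound_freq q) (\<lambda>_. 1) has_vector_derivative of_real (Z' u)) (at u)"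
      by (rule has_vector_derivative_transform_within_open[of _ _ _ "{0<..<1}"])
        (use u in \<open>auto simp: sound_ansatz_sound_freq t_def\<close>)
    show "((\<lambda>u. complex_of_real (Z' u)) has_vector_derivative of_real (Z'' u)) (at u)"
      unfolding Z'_def Z''_def
      by (intro has_vector_derivative_of_real sound_profile_deriv2 u)
    \<comment> \<open>Every term is real and a multiple of the profile, which factors out and leaves
      the left side of \<open>sound_equation_identity\<close>.\<close>
    have "of_real (Z'' u) + sound_coeff1 q (sound_freq q) u * of_real (Z' u)
        + sound_coeff0 q (sound_freq q) u * sound_ansatz q (sound_freq q) (\<lambda>_. 1) u
      = complex_of_real (sound_profile t u * (t * (1 + t) / (u * (1 - u))^2
          + (u + 2 * t) / ((1 - u) * (u - 2 - 2 * t)) * ((1 + t - u) / (u * (1 - u)))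
          + (u^2 * (u - 1) + (u^2 - 3 * u + 2) * t - (3 * u - 4) * t^2 + 2 * t^3)
             / (u^2 * (1 - u)^2 * (u - 2 - 2 * t))))"
      unfolding sound_coeff1_sound_freq[OF assms] sound_coeff0_sound_freq[OF assms]
        sound_ansatz_sound_freq[OF u] t(2) t_def[symmetric] Z'_def Z''_def
        of_real_mult[symmetric] of_real_add[symmetric] of_real_eq_iff
      by (simp only: distrib_left mult_ac)
    also have "\<dots> = 0"
      using sound_equation_identity[OF u t(1)] by simp
    finally show "of_real (Z'' u) + sound_coeff1 q (sound_freq q) u * of_real (Z' u)
        + sound_coeff0 q (sound_freq q) u * sound_ansatz q (sound_freq q) (\<lambda>_. 1) u = 0" .
  qed
  then show ?thesis
    unfolding sound_solution_def by (intro exI ballI)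
qed

text \<open>The constant \<open>y = 1\<close> is entire and has no zeros, so the conditions at both
  ends hold at once.\<close>

lemma sound_quasinormal_mode_sound_freq:
  assumes "q \<noteq> 0"
  shows "sound_quasinormal_mode q (sound_freq q) (sound_ansatz q (sound_freq q) (\<lambda>_. 1))"
  unfolding sound_quasinormal_mode_def
proof (intro conjI exI[of _ "\<lambda>_. 1"] ballI)
  show "sound_solution q (sound_freq q) (sound_ansatz q (sound_freq q) (\<lambda>_. 1))"
    by (rule sound_solution_sound_freq[OF assms])
  show "0 < Re (infinity_root q (sound_freq q))"
    by (simp add: infinity_root_sound_freq add_pos_nonneg)
qed auto

text \<open>Expresses that the dispersion relation has no linear term.\<close>

lemma sound_freq_deriv_0: "(sound_freq has_vector_derivative 0) (at 0)"
  proof -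
  have "((\<lambda>q::real. q^2 / 2) has_real_derivative 0) (at 0)"
    by (auto intro!: derivative_eq_intros)
  from has_vector_derivative_mult_right[OF has_vector_derivative_of_real[OF this], of "- \<i>"]
  show ?thesis
    by (simp add: sound_freq_def[abs_def])
qed

lemma sound_speed_0: "((\<lambda>q. sound_freq q / of_real q) \<longlongrightarrow> 0) (at 0)"
proof -
  \<comment> \<open>This holds at \<open>q = 0\<close> too, where division by zero gives 0 on the
    left.\<close>
  have "sound_freq q / of_real q = - \<i> * of_real (q / 2)" for q
    by (simp add: sound_freq_def power2_eq_square)
  moreover have "((\<lambda>q::real. - \<i> * of_real (q / 2)) \<longlongrightarrow> - \<i> * of_real (0 / 2)) (at 0)"
    by (intro tendsto_intros) simp
  ultimately show ?thesis
    by simp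
qed

theorem mainTheorem4:
  "(\<forall>q::real. q \<noteq> 0 \<longrightarrow>
      (let w = - \<i> * of_real (q^2 / 2)
       in sound_solution q w (sound_ansatz q w (\<lambda>_. 1)))) \<and>
   (\<exists>w :: real \<Rightarrow> complex.
      (\<forall>q. w q = - \<i> * of_real (q^2 / 2)) \<and>
      (\<forall>q. q \<noteq> 0 \<longrightarrow> (\<exists>Z. sound_quasinormal_mode q (w q) Z)) \<and>
      (w has_vector_derivative 0) (at 0) \<and>
      ((\<lambda>q. w q / of_real q) \<longlongrightarrow> 0) (at 0))"
  unfolding Let_def sound_freq_def[symmetric]
  using sound_solution_sound_freq sound_quasinormal_mode_sound_freq sound_freq_deriv_0 sound_speed_0
  by blast

end
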